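(* Every formula $\varphi\in \mathrm{TeamLTL}^{l}(\vee_B)$ is logically equivalent to a formula $\varphi^*= \bigvee_{B,\,i\in I} \alpha_i$ in $\vee_B$-disjunctive normal form, where the $\alpha_i$ are LTL-formulae, $\lvert \alpha_i \rvert \leq \lvert \varphi \rvert$ and $\lvert I \rvert = 2^k$, where $k$ is the number of occurrences of $\vee_B$ in $\varphi$.
   Context: $\mathrm{TeamLTL}^l$ is LTL (negation normal form, operators $\wedge,\vee,\mathsf{X},\mathsf{G},\mathsf{U}$) under the lax set-based asynchronous team semantics $\models^l$ (split disjunction $T=T_1\cup T_2$; $\mathsf{G}$ and $\mathsf{U}$ quantify over functions $f\colon T\to\mathcal P(\mathbb N)\setminus\{\emptyset\}$ assigning sets of time points to each trace). $\vee_B$ denotes the Boolean disjunction ($T\models^l\varphi\vee_B\psi$ iff $T\models^l\varphi$ or $T\models^l\psi$), and $\bigvee_{B,i\in I}$ its iterated form. A formula is in $\vee_B$-disjunctive normal form if it is a Boolean disjunction of LTL-formulae. *)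

theory Defs
  imports Main "HOL-Library.Omega_Words_Fun" "HOL-Library.FuncSet"
begin

text \<open>Formulae of TeamLTL(\<open>\<or>\<^sub>B\<close>) in negation normal form; \<open>Or\<close> is the split disjunction and
  \<open>BOr\<close> the Boolean disjunction.\<close>

datatype 'a formula =
    Prop 'a
  | NProp 'a
  | And "'a formula" "'a formula"
  | Or "'a formula" "'a formula"
  | BOr "'a formula" "'a formula"
  | Next "'a formula"
  | Glob "'a formula"
  | Until "'a formula" "'a formula"

primrec is_LTL :: "'a formula \<Rightarrow> bool" where
  "is_LTL (Prop p) = True"
| "is_LTL (NProp p) = True"
| "is_LTL (And \<phi> \<psi>) = (is_LTL \<phi> \<and> is_LTL \<psi>)"
| "is_LTL (Or \<phi> \<psi>) = (is_LTL \<phi> \<and> is_LTL \<psi>)"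
| "is_LTL (BOr \<phi> \<psi>) = False"
| "is_LTL (Next \<phi>) = is_LTL \<phi>"
| "is_LTL (Glob \<phi>) = is_LTL \<phi>"
| "is_LTL (Until \<phi> \<psi>) = (is_LTL \<phi> \<and> is_LTL \<psi>)"

text \<open>The length \<open>|\<phi>|\<close> is the number of occurrences of symbols (propositions and connectives).\<close>

primrec formula_length :: "'a formula \<Rightarrow> nat" where
  "formula_length (Prop p) = 1"
| "formula_length (NProp p) = 2"
| "formula_length (And \<phi> \<psi>) = formula_length \<phi> + formula_length \<psi> + 1"
| "formula_length (Or \<phi> \<psi>) = formula_length \<phi> + formula_length \<psi> + 1"
| "formula_length (BOr \<phi> \<psi>) = formula_length \<phi> + formula_length \<psi> + 1"
| "formula_length (Next \<phi>) = formula_length \<phi> + 1"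
| "formula_length (Glob \<phi>) = formula_length \<phi> + 1"
| "formula_length (Until \<phi> \<psi>) = formula_length \<phi> + formula_length \<psi> + 1"

primrec count_BOr :: "'a formula \<Rightarrow> nat" where
  "count_BOr (Prop p) = 0"
| "count_BOr (NProp p) = 0"
| "count_BOr (And \<phi> \<psi>) = count_BOr \<phi> + count_BOr \<psi>"
| "count_BOr (Or \<phi> \<psi>) = count_BOr \<phi> + count_BOr \<psi>"
| "count_BOr (BOr \<phi> \<psi>) = count_BOr \<phi> + count_BOr \<psi> + 1"
| "count_BOr (Next \<phi>) = count_BOr \<phi>"
| "count_BOr (Glob \<phi>) = count_BOr \<phi>"
| "count_BOr (Until \<phi> \<psi>) = count_BOr \<phi> + count_BOr \<psi>"

text \<open>Iterated Boolean disjunction of a non-empty finite family, given as a list; the value on the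
  empty list is left unspecified.\<close>

fun Big_BOr :: "'a formula list \<Rightarrow> 'a formula" where
  "Big_BOr [\<alpha>] = \<alpha>"
| "Big_BOr (\<alpha> # \<beta> # \<alpha>s) = BOr \<alpha> (Big_BOr (\<beta> # \<alpha>s))"

type_synonym 'a trace = "'a set word"
type_synonym 'a team = "'a trace set"

abbreviation nonempty_nat_sets :: "nat set set" where
  "nonempty_nat_sets \<equiv> Pow UNIV - {{}}"

text \<open>\<open>T[f,\<infinity>]\<close>. Functions with domain \<open>T\<close> are represented by total functions of which only the
  values on \<open>T\<close> matter.\<close>

definition team_shift :: "'a team \<Rightarrow> ('a trace \<Rightarrow> nat set) \<Rightarrow> 'a team" where
  "team_shift T f = {suffix s t | s t. t \<in> T \<and> s \<in> f t}"

text \<open>The order \<open>f' < f\<close> for \<open>f' : T' \<rightarrow> P(\<nat>) - {\<emptyset>}\<close>: pointwise on \<open>T'\<close>, \<open>min f'(t) \<le> min f(t)\<close> and, if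
  \<open>max f(t)\<close> exists, \<open>max f'(t) < max f(t)\<close>. The maximum of a non-empty set of natural numbers exists
  iff the set is finite; \<open>Inf\<close> gives the minimum also for infinite sets.\<close>

definition shift_less ::
    "'a team \<Rightarrow> ('a trace \<Rightarrow> nat set) \<Rightarrow> ('a trace \<Rightarrow> nat set) \<Rightarrow> bool" where
  "shift_less T' f' f \<longleftrightarrow>
    (\<forall>t\<in>T'. Inf (f' t) \<le> Inf (f t) \<and>
      (finite (f t) \<longrightarrow> finite (f' t) \<and> Max (f' t) < Max (f t)))"

text \<open>\<open>{t \<in> T. max f(t) \<noteq> 0}\<close>; traces for which the maximum does not exist are included.\<close>

definition nonzero_part :: "'a team \<Rightarrow> ('a trace \<Rightarrow> nat set) \<Rightarrow> 'a team" where
  "nonzero_part T f = {t \<in> T. \<not> (finite (f t) \<and> Max (f t) = 0)}"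

primrec lax_sat :: "'a team \<Rightarrow> 'a formula \<Rightarrow> bool" (infix "\<Turnstile>\<^sub>l" 50) where
  "T \<Turnstile>\<^sub>l Prop p \<longleftrightarrow> (\<forall>t\<in>T. p \<in> t 0)"
| "T \<Turnstile>\<^sub>l NProp p \<longleftrightarrow> (\<forall>t\<in>T. p \<notin> t 0)"
| "T \<Turnstile>\<^sub>l And \<phi> \<psi> \<longleftrightarrow> T \<Turnstile>\<^sub>l \<phi> \<and> T \<Turnstile>\<^sub>l \<psi>"
| "T \<Turnstile>\<^sub>l Or \<phi> \<psi> \<longleftrightarrow> (\<exists>T1 T2. T = T1 \<union> T2 \<and> T1 \<Turnstile>\<^sub>l \<phi> \<and> T2 \<Turnstile>\<^sub>l \<psi>)"
| "T \<Turnstile>\<^sub>l BOr \<phi> \<psi> \<longleftrightarrow> T \<Turnstile>\<^sub>l \<phi> \<or> T \<Turnstile>\<^sub>l \<psi>"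
| "T \<Turnstile>\<^sub>l Next \<phi> \<longleftrightarrow> suffix 1 ` T \<Turnstile>\<^sub>l \<phi>"
| "T \<Turnstile>\<^sub>l Glob \<phi> \<longleftrightarrow> (\<forall>f \<in> T \<rightarrow> nonempty_nat_sets. team_shift T f \<Turnstile>\<^sub>l \<phi>)"
| "T \<Turnstile>\<^sub>l Until \<phi> \<psi> \<longleftrightarrow>
    (\<exists>f \<in> T \<rightarrow> nonempty_nat_sets. team_shift T f \<Turnstile>\<^sub>l \<psi> \<and>
      (\<forall>f' \<in> nonzero_part T f \<rightarrow> nonempty_nat_sets.
        shift_less (nonzero_part T f) f' f \<longrightarrow>
          team_shift (nonzero_part T f) f' \<Turnstile>\<^sub>l \<phi> \<or> nonzero_part T f = {}))"

definition lax_equiv :: "'a formula \<Rightarrow> 'a formula \<Rightarrow> bool" (infix "\<equiv>\<^sub>l" 50) where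
  "\<phi> \<equiv>\<^sub>l \<psi> \<longleftrightarrow> (\<forall>T. T \<Turnstile>\<^sub>l \<phi> \<longleftrightarrow> T \<Turnstile>\<^sub>l \<psi>)"

end

theory Submission imports Defs begin

text \<open>The disjuncts arise by resolving every occurrence of \<open>\<or>\<^sub>B\<close> to one of its arguments, so
  it suffices that \<open>\<or>\<^sub>B\<close> can be pulled out of every connective. The only critical cases are
  the universal quantifiers over time-point functions in \<open>G\<close> and in the left argument of \<open>U\<close>. Since
  satisfaction is closed under subteams, such a quantifier is equivalent to its instance at the
  pointwise largest admissible function, and a single instance commutes with \<open>\<or>\<^sub>B\<close>.\<close>

lemma team_shift_mono:
  assumes "S \<subseteq> T" and "\<And>t. t \<in> S \<Longrightarrow> f t \<subseteq> g t"
  shows "team_shift S f \<subseteq> team_shift T g"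
  using assms unfolding team_shift_def by blast

lemma team_shift_empty [simp]: "team_shift {} f = {}"
  by (simp add: team_shift_def)

lemma nonzero_part_empty [simp]: "nonzero_part {} f = {}"
  by (simp add: nonzero_part_def)

lemma nonzero_part_mono: "S \<subseteq> T \<Longrightarrow> nonzero_part S f \<subseteq> nonzero_part T f"
  by (auto simp: nonzero_part_def)

lemma lax_sat_empty: "{} \<Turnstile>\<^sub>l \<phi>"
  by (induction \<phi>) auto

text \<open>Stated per formula, so that the characterisations of \<open>Glob\<close> and
  \<open>Until\<close> can assume it of a subformula inside the induction that proves it for all
  formulae.\<close>

definition down_closed :: "'a formula \<Rightarrow> bool" where
  "down_closed \<phi> \<longleftrightarrow> (\<forall>S T. S \<subseteq> T \<longrightarrow> T \<Turnstile>\<^sub>l \<phi> \<longrightarrow> S \<Turnstile>\<^sub>l \<phi>)"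

lemma down_closedD: "down_closed \<phi> \<Longrightarrow> T \<Turnstile>\<^sub>l \<phi> \<Longrightarrow> S \<subseteq> T \<Longrightarrow> S \<Turnstile>\<^sub>l \<phi>"
  by (auto simp: down_closed_def)

text \<open>The constant function \<open>UNIV\<close> is admissible, and its shift contains the
  shift by any other function.\<close>

lemma lax_sat_Glob_iff:
  assumes "down_closed \<phi>"
  shows "T \<Turnstile>\<^sub>l Glob \<phi> \<longleftrightarrow> team_shift T (\<lambda>_. UNIV) \<Turnstile>\<^sub>l \<phi>"
proof
  assume "T \<Turnstile>\<^sub>l Glob \<phi>"
  then show "team_shift T (\<lambda>_. UNIV) \<Turnstile>\<^sub>l \<phi>" by auto
next
  assume "team_shift T (\<lambda>_. UNIV) \<Turnstile>\<^sub>l \<phi>"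
  then show "T \<Turnstile>\<^sub>l Glob \<phi>"
    using down_closedD[OF assms] by (simp add: team_shift_mono)
qed

text \<open>The largest candidate for \<open>f'\<close> under \<open>shift_less\<close>: a maximum
  of \<open>f t\<close> has to be undercut strictly, while an infinite \<open>f t\<close> gives no
  upper bound. Maximum 0 would leave the empty set, but \<open>nonzero_part\<close> excludes
  it.\<close>

definition greatest_below :: "('a trace \<Rightarrow> nat set) \<Rightarrow> 'a trace \<Rightarrow> nat set" where
  "greatest_below f t = (if finite (f t) then {..<Max (f t)} else UNIV)"

lemma greatest_below_nonempty:
  "greatest_below f \<in> nonzero_part T f \<rightarrow> nonempty_nat_sets"
  by (auto simp: greatest_below_def nonzero_part_def lessThan_empty_iff)

lemma shift_less_greatest_below:
  "shift_less (nonzero_part T f) (greatest_below f) f"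
proof -
  have "Inf (greatest_below f t) \<le> Inf (f t) \<and>
      (finite (f t) \<longrightarrow> finite (greatest_below f t) \<and> Max (greatest_below f t) < Max (f t))"
    if t: "t \<in> nonzero_part T f" for t
  proof -
    \<comment> \<open>Containing 0 settles the condition on minima and gives the nonemptiness that
      \<open>Max_in\<close> requires.\<close>
    have "0 \<in> greatest_below f t"
      using t by (auto simp: greatest_below_def nonzero_part_def)
    then have "Inf (greatest_below f t) = 0" and "greatest_below f t \<noteq> {}"
      using cInf_lower[of 0 "greatest_below f t"] by auto
    moreover from this have "Max (greatest_below f t) < Max (f t)" if "finite (f t)"
      using that Max_in[of "greatest_below f t"] by (auto simp: greatest_below_def)
    ultimately show ?thesis
      by (simp add: greatest_below_def)
  qed
  then show ?thesis by (simp add: shift_less_def)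
qed

lemma shift_less_imp_subset_greatest_below:
  assumes "shift_less S f' f" and "t \<in> S"
  shows "f' t \<subseteq> greatest_below f t"
proof
  fix n assume "n \<in> f' t"
  then have "n \<le> Max (f' t)" if "finite (f' t)"
    using that by simp
  with assms show "n \<in> greatest_below f t"
    by (auto simp: shift_less_def greatest_below_def dest: bspec)
qed

text \<open>Only the universal quantifier over \<open>f'\<close> collapses:
  \<open>greatest_below f\<close> is one of its instances, and its shift contains all the
  others.\<close>

lemma lax_sat_Until_iff:
  assumes "down_closed \<phi>"
  shows "T \<Turnstile>\<^sub>l Until \<phi> \<psi> \<longleftrightarrow>
    (\<exists>f \<in> T \<rightarrow> nonempty_nat_sets. team_shift T f \<Turnstile>\<^sub>l \<psi> \<and>
      team_shift (nonzero_part T f) (greatest_below f) \<Turnstile>\<^sub>l \<phi>)"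
proof -
  have "(\<forall>f' \<in> nonzero_part T f \<rightarrow> nonempty_nat_sets.
        shift_less (nonzero_part T f) f' f \<longrightarrow>
          team_shift (nonzero_part T f) f' \<Turnstile>\<^sub>l \<phi> \<or> nonzero_part T f = {}) \<longleftrightarrow>
      team_shift (nonzero_part T f) (greatest_below f) \<Turnstile>\<^sub>l \<phi>" (is "?all \<longleftrightarrow> ?inst") for f
  proof
    assume ?all
    \<comment> \<open>If \<open>nonzero_part T f\<close> is empty, \<open>?all\<close> says nothing,
      but \<open>?inst\<close> then concerns the empty team.\<close>
    then show ?inst
      using greatest_below_nonempty[of f T] shift_less_greatest_below[of T f]
        lax_sat_empty[of \<phi>] by (metis team_shift_empty)
  next
    assume inst: ?inst
    then show ?all
      by (intro ballI impI disjI1 down_closedD[OF assms inst] team_shift_mono order_refl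
          shift_less_imp_subset_greatest_below)
  qed
  then show ?thesis by simp
qed

lemma down_closed: "down_closed \<phi>"
proof (induction \<phi>)
  case (Or \<phi> \<psi>)
  show ?case
    unfolding down_closed_def
  proof (intro allI impI)
    fix S T :: "'a team"
    assume "S \<subseteq> T" "T \<Turnstile>\<^sub>l Or \<phi> \<psi>"
    then obtain T1 T2 where T: "S \<subseteq> T1 \<union> T2" "T1 \<Turnstile>\<^sub>l \<phi>" "T2 \<Turnstile>\<^sub>l \<psi>" by auto
    then have "S \<inter> T1 \<Turnstile>\<^sub>l \<phi>" "S \<inter> T2 \<Turnstile>\<^sub>l \<psi>"
      using Or.IH by (auto elim: down_closedD)
    moreover have "S = (S \<inter> T1) \<union> (S \<inter> T2)" using T by blast
    ultimately show "S \<Turnstile>\<^sub>l Or \<phi> \<psi>" unfolding lax_sat.simps by blast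
  qed
next
  case (Next \<phi>)
  then show ?case
    unfolding down_closed_def lax_sat.simps by (meson image_mono)
next
  case (Glob \<phi>)
  then show ?case
    unfolding down_closed_def[of "Glob \<phi>"] lax_sat_Glob_iff[OF Glob]
    by (meson down_closedD team_shift_mono order_refl)
next
  case (Until \<phi> \<psi>)
  show ?case
    unfolding down_closed_def lax_sat_Until_iff[OF Until.IH(1)]
  proof (intro allI impI, elim bexE conjE)
    fix S T :: "'a team" and f
    assume ST: "S \<subseteq> T" and f: "f \<in> T \<rightarrow> nonempty_nat_sets"
      and sat: "team_shift T f \<Turnstile>\<^sub>l \<psi>"
        "team_shift (nonzero_part T f) (greatest_below f) \<Turnstile>\<^sub>l \<phi>"
    \<comment> \<open>The same \<open>f\<close> serves the subteam, because both shifted teams only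
      shrink.\<close>
    have "f \<in> S \<rightarrow> nonempty_nat_sets" using ST f by blast
    moreover have "team_shift S f \<Turnstile>\<^sub>l \<psi>"
      using down_closedD[OF Until.IH(2) sat(1)] ST by (simp add: team_shift_mono)
    moreover have "team_shift (nonzero_part S f) (greatest_below f) \<Turnstile>\<^sub>l \<phi>"
      using down_closedD[OF Until.IH(1) sat(2)] ST
      by (simp add: team_shift_mono nonzero_part_mono)
    ultimately show "\<exists>f \<in> S \<rightarrow> nonempty_nat_sets. team_shift S f \<Turnstile>\<^sub>l \<psi> \<and>
        team_shift (nonzero_part S f) (greatest_below f) \<Turnstile>\<^sub>l \<phi>" by blast
  qed
qed (auto simp: down_closed_def)

text \<open>In the case of \<open>BOr\<close> every disjunct is repeated, since the number of disjuncts has to be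
  exactly \<open>2 ^ count_BOr \<phi>\<close>.\<close>

primrec disjuncts :: "'a formula \<Rightarrow> 'a formula list" where
  "disjuncts (Prop p) = [Prop p]"
| "disjuncts (NProp p) = [NProp p]"
| "disjuncts (And \<phi> \<psi>) = map (case_prod And) (List.product (disjuncts \<phi>) (disjuncts \<psi>))"
| "disjuncts (Or \<phi> \<psi>) = map (case_prod Or) (List.product (disjuncts \<phi>) (disjuncts \<psi>))"
| "disjuncts (BOr \<phi> \<psi>) =
    (let ps = List.product (disjuncts \<phi>) (disjuncts \<psi>) in map fst ps @ map snd ps)"
| "disjuncts (Next \<phi>) = map Next (disjuncts \<phi>)"
| "disjuncts (Glob \<phi>) = map Glob (disjuncts \<phi>)"
| "disjuncts (Until \<phi> \<psi>) = map (case_prod Until) (List.product (disjuncts \<phi>) (disjuncts \<psi>))"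

text \<open>Every binary connective multiplies the lengths; \<open>BOr\<close> lists each pair
  twice, once per component, which is the extra factor 2.\<close>

lemma length_disjuncts: "length (disjuncts \<phi>) = 2 ^ count_BOr \<phi>"
  by (induction \<phi>) (simp_all add: Let_def power_add)

lemma disjuncts_nonempty: "disjuncts \<phi> \<noteq> []"
  using length_disjuncts[of \<phi>] by force

text \<open>Each projection of the product is onto because the other factor is nonempty.\<close>

lemma set_disjuncts_BOr:
  "set (disjuncts (BOr \<phi> \<psi>)) = set (disjuncts \<phi>) \<union> set (disjuncts \<psi>)"
  by (simp add: Let_def disjuncts_nonempty)

lemma is_LTL_disjuncts: "\<alpha> \<in> set (disjuncts \<phi>) \<Longrightarrow> is_LTL \<alpha>"
  by (induction \<phi> arbitrary: \<alpha>) (auto simp: Let_def disjuncts_nonempty)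

lemma formula_length_disjuncts:
  "\<alpha> \<in> set (disjuncts \<phi>) \<Longrightarrow> formula_length \<alpha> \<le> formula_length \<phi>"
  by (induction \<phi> arbitrary: \<alpha>)
    (auto simp: Let_def disjuncts_nonempty intro!: add_mono intro: le_SucI trans_le_add1 trans_le_add2)

lemma lax_sat_disjuncts: "T \<Turnstile>\<^sub>l \<phi> \<longleftrightarrow> (\<exists>\<alpha> \<in> set (disjuncts \<phi>). T \<Turnstile>\<^sub>l \<alpha>)"
proof (induction \<phi> arbitrary: T)
  case (Or \<phi> \<psi>)
  show ?case
    unfolding lax_sat.simps Or.IH[of T for T] by auto
next
  case (BOr \<phi> \<psi>)
  then show ?case
    unfolding set_disjuncts_BOr by auto
next
  case (Glob \<phi>)
  \<comment> \<open>In its single-instance form \<open>Glob\<close> speaks of one team, so the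
    induction hypothesis at that team supplies the disjunct.\<close>
  then show ?case
    by (simp add: lax_sat_Glob_iff[OF down_closed] del: lax_sat.simps)
next
  case (Until \<phi> \<psi>)
  \<comment> \<open>Only the existential quantifier over \<open>f\<close> remains, and it commutes
    with the choice of the two disjuncts.\<close>
  show ?case
    by (simp add: lax_sat_Until_iff[OF down_closed] Until.IH del: lax_sat.simps)
      blast
qed auto

lemma lax_sat_Big_BOr:
  "\<alpha>s \<noteq> [] \<Longrightarrow> T \<Turnstile>\<^sub>l Big_BOr \<alpha>s \<longleftrightarrow> (\<exists>\<alpha> \<in> set \<alpha>s. T \<Turnstile>\<^sub>l \<alpha>)"
  by (induction \<alpha>s rule: Big_BOr.induct) auto

theorem theorem10:
  fixes \<phi> :: "'a formula"
  shows "\<exists>\<alpha>s :: 'a formula list.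
    length \<alpha>s = 2 ^ count_BOr \<phi> \<and>
    (\<forall>\<alpha> \<in> set \<alpha>s. is_LTL \<alpha> \<and> formula_length \<alpha> \<le> formula_length \<phi>) \<and>
    \<phi> \<equiv>\<^sub>l Big_BOr \<alpha>s"
proof (intro exI[of _ "disjuncts \<phi>"] conjI ballI)
  show "\<phi> \<equiv>\<^sub>l Big_BOr (disjuncts \<phi>)"
    using lax_sat_disjuncts[of _ \<phi>]
    by (simp add: lax_equiv_def lax_sat_Big_BOr disjuncts_nonempty)
qed (simp_all add: length_disjuncts is_LTL_disjuncts formula_length_disjuncts)

end
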